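(* Let $k$ be a field, $\lambda\in k$, $C$ a coalgebra over $k$, and $(M,P,T)$ a Rota-Baxter paired $C$-comodule of weight $\lambda$. Define $\overline{P}=-P-\lambda\,\mathrm{id}$ and $\overline{T}=-T-\lambda\,\mathrm{id}$. Then $(M,\overline{P},\overline{T})$ is also a Rota-Baxter paired $C$-comodule of weight $\lambda$.
   Context: All spaces, maps and tensor products are over $k$. For a left $C$-comodule $M$ with coaction $\rho:M\to C\otimes M$ and linear maps $P:C\to C$, $T:M\to M$, the triple $(M,P,T)$ is a Rota-Baxter paired (left) $C$-comodule of weight $\lambda$ if $$(P\otimes T)\rho=(P\otimes \mathrm{id})\rho T+(\mathrm{id}\otimes T)\rho T+\lambda\rho T.$$ *)

theory Defs
  imports "HOL-Algebra.Module" "HOL-Algebra.AbelCoset"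
begin

section \<open>Linear maps between modules\<close>

definition linear_maps ::
    "('k, 'r) ring_scheme \<Rightarrow> ('k, 'a, 'x) module_scheme \<Rightarrow> ('k, 'b, 'y) module_scheme \<Rightarrow> ('a \<Rightarrow> 'b) set"
  where "linear_maps K A B =
    {f \<in> carrier A \<rightarrow> carrier B.
       (\<forall>x\<in>carrier A. \<forall>y\<in>carrier A. f (x \<oplus>\<^bsub>A\<^esub> y) = f x \<oplus>\<^bsub>B\<^esub> f y) \<and>
       (\<forall>r\<in>carrier K. \<forall>x\<in>carrier A. f (r \<odot>\<^bsub>A\<^esub> x) = r \<odot>\<^bsub>B\<^esub> f x)}"

definition bilinear_maps ::
    "('k, 'r) ring_scheme \<Rightarrow> ('k, 'a, 'x) module_scheme \<Rightarrow> ('k, 'b, 'y) module_scheme \<Rightarrow>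
     ('k, 'd, 'z) module_scheme \<Rightarrow> ('a \<Rightarrow> 'b \<Rightarrow> 'd) set"
  where "bilinear_maps K A B D =
    {\<beta>. (\<forall>a\<in>carrier A. \<beta> a \<in> linear_maps K B D) \<and>
        (\<forall>b\<in>carrier B. (\<lambda>a. \<beta> a b) \<in> linear_maps K A D)}"

text \<open>The fields \<open>mult\<close> and \<open>one\<close> that a module record inherits from the ring record are
  irrelevant to the module structure; they are left unspecified below.\<close>

definition ring_as_module :: "('k, 'r) ring_scheme \<Rightarrow> ('k, 'k) module"
  where "ring_as_module K =
    \<lparr>carrier = carrier K, monoid.mult = undefined, one = undefined,
     zero = \<zero>\<^bsub>K\<^esub>, add = (\<lambda>x y. x \<oplus>\<^bsub>K\<^esub> y), smult = (\<lambda>r x. r \<otimes>\<^bsub>K\<^esub> x)\<rparr>"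


section \<open>Free modules and quotient modules\<close>

definition free_module :: "('k, 'r) ring_scheme \<Rightarrow> 's set \<Rightarrow> ('k, 's \<Rightarrow> 'k) module"
  where "free_module K S =
    \<lparr>carrier = {x. (\<forall>s\<in>S. x s \<in> carrier K) \<and> (\<forall>s. s \<notin> S \<longrightarrow> x s = \<zero>\<^bsub>K\<^esub>) \<and>
                   finite {s. x s \<noteq> \<zero>\<^bsub>K\<^esub>}},
     monoid.mult = undefined, one = undefined,
     zero = (\<lambda>s. \<zero>\<^bsub>K\<^esub>),
     add = (\<lambda>x y s. x s \<oplus>\<^bsub>K\<^esub> y s),
     smult = (\<lambda>r x s. r \<otimes>\<^bsub>K\<^esub> x s)\<rparr>"

definition free_gen :: "('k, 'r) ring_scheme \<Rightarrow> 's \<Rightarrow> 's \<Rightarrow> 'k"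
  where "free_gen K s = (\<lambda>t. if t = s then \<one>\<^bsub>K\<^esub> else \<zero>\<^bsub>K\<^esub>)"

definition submodule_span ::
    "('k, 'r) ring_scheme \<Rightarrow> ('k, 'a, 'x) module_scheme \<Rightarrow> 'a set \<Rightarrow> 'a set"
  where "submodule_span K F X = \<Inter>{N. submodule N K F \<and> X \<subseteq> N}"

definition quotient_module ::
    "('k, 'r) ring_scheme \<Rightarrow> ('k, 'a, 'x) module_scheme \<Rightarrow> 'a set \<Rightarrow> ('k, 'a set) module"
  where "quotient_module K F N =
    \<lparr>carrier = a_rcosets\<^bsub>F\<^esub> N,
     monoid.mult = undefined, one = undefined,
     zero = N,
     add = (\<lambda>X Y. X <+>\<^bsub>F\<^esub> Y),
     smult = (\<lambda>r X. \<Union>x\<in>X. N +>\<^bsub>F\<^esub> (r \<odot>\<^bsub>F\<^esub> x))\<rparr>"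


section \<open>Tensor products\<close>

text \<open>\<open>A \<otimes> B\<close> is the free module on \<open>carrier A \<times> carrier B\<close> modulo the bilinearity relations.\<close>

definition tensor_relations ::
    "('k, 'r) ring_scheme \<Rightarrow> ('k, 'a, 'x) module_scheme \<Rightarrow> ('k, 'b, 'y) module_scheme \<Rightarrow>
     ('a \<times> 'b \<Rightarrow> 'k) set"
  where "tensor_relations K A B =
    (let F = free_module K (carrier A \<times> carrier B); e = (\<lambda>a b. free_gen K (a, b)) in
      {e (a \<oplus>\<^bsub>A\<^esub> a') b \<ominus>\<^bsub>F\<^esub> (e a b \<oplus>\<^bsub>F\<^esub> e a' b) | a a' b.
         a \<in> carrier A \<and> a' \<in> carrier A \<and> b \<in> carrier B} \<union>
      {e a (b \<oplus>\<^bsub>B\<^esub> b') \<ominus>\<^bsub>F\<^esub> (e a b \<oplus>\<^bsub>F\<^esub> e a b') | a b b'.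
         a \<in> carrier A \<and> b \<in> carrier B \<and> b' \<in> carrier B} \<union>
      {e (r \<odot>\<^bsub>A\<^esub> a) b \<ominus>\<^bsub>F\<^esub> r \<odot>\<^bsub>F\<^esub> e a b | r a b.
         r \<in> carrier K \<and> a \<in> carrier A \<and> b \<in> carrier B} \<union>
      {e a (r \<odot>\<^bsub>B\<^esub> b) \<ominus>\<^bsub>F\<^esub> r \<odot>\<^bsub>F\<^esub> e a b | r a b.
         r \<in> carrier K \<and> a \<in> carrier A \<and> b \<in> carrier B})"

definition tensor_kernel ::
    "('k, 'r) ring_scheme \<Rightarrow> ('k, 'a, 'x) module_scheme \<Rightarrow> ('k, 'b, 'y) module_scheme \<Rightarrow>
     ('a \<times> 'b \<Rightarrow> 'k) set"
  where "tensor_kernel K A B =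
    submodule_span K (free_module K (carrier A \<times> carrier B)) (tensor_relations K A B)"

definition tensor ::
    "('k, 'r) ring_scheme \<Rightarrow> ('k, 'a, 'x) module_scheme \<Rightarrow> ('k, 'b, 'y) module_scheme \<Rightarrow>
     ('k, ('a \<times> 'b \<Rightarrow> 'k) set) module"
  where "tensor K A B =
    quotient_module K (free_module K (carrier A \<times> carrier B)) (tensor_kernel K A B)"

definition pure_tensor ::
    "('k, 'r) ring_scheme \<Rightarrow> ('k, 'a, 'x) module_scheme \<Rightarrow> ('k, 'b, 'y) module_scheme \<Rightarrow>
     'a \<Rightarrow> 'b \<Rightarrow> ('a \<times> 'b \<Rightarrow> 'k) set"
  where "pure_tensor K A B a b =
    tensor_kernel K A B +>\<^bsub>free_module K (carrier A \<times> carrier B)\<^esub> free_gen K (a, b)"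

text \<open>The linear map \<open>A \<otimes> B \<rightarrow> D\<close> induced by a bilinear map \<open>\<beta>\<close>, evaluated on a representative
  of the coset; the lemmas \<open>tensor_lift_linear\<close> and \<open>tensor_lift_pure\<close> below show that the choice
  of representative is immaterial.\<close>

definition tensor_lift ::
    "('k, 'r) ring_scheme \<Rightarrow> ('k, 'd, 'z) module_scheme \<Rightarrow> ('a \<Rightarrow> 'b \<Rightarrow> 'd) \<Rightarrow>
     ('a \<times> 'b \<Rightarrow> 'k) set \<Rightarrow> 'd"
  where "tensor_lift K D \<beta> X =
    (let x = (SOME x. x \<in> X) in
      (\<Oplus>\<^bsub>D\<^esub>p\<in>{p. x p \<noteq> \<zero>\<^bsub>K\<^esub>}. x p \<odot>\<^bsub>D\<^esub> \<beta> (fst p) (snd p)))"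

text \<open>\<open>f \<otimes> g\<close>, where \<open>A'\<close> and \<open>B'\<close> are the codomains of \<open>f\<close> and \<open>g\<close>.\<close>

definition tensor_map ::
    "('k, 'r) ring_scheme \<Rightarrow> ('k, 'c, 'x) module_scheme \<Rightarrow> ('k, 'd, 'y) module_scheme \<Rightarrow>
     ('a \<Rightarrow> 'c) \<Rightarrow> ('b \<Rightarrow> 'd) \<Rightarrow> ('a \<times> 'b \<Rightarrow> 'k) set \<Rightarrow> ('c \<times> 'd \<Rightarrow> 'k) set"
  where "tensor_map K A' B' f g =
    tensor_lift K (tensor K A' B') (\<lambda>a b. pure_tensor K A' B' (f a) (g b))"

text \<open>The canonical map \<open>(A \<otimes> B) \<otimes> D \<rightarrow> A \<otimes> (B \<otimes> D)\<close>.\<close>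

definition tensor_assoc ::
    "('k, 'r) ring_scheme \<Rightarrow> ('k, 'a, 'x) module_scheme \<Rightarrow> ('k, 'b, 'y) module_scheme \<Rightarrow>
     ('k, 'd, 'z) module_scheme \<Rightarrow>
     (('a \<times> 'b \<Rightarrow> 'k) set \<times> 'd \<Rightarrow> 'k) set \<Rightarrow> ('a \<times> ('b \<times> 'd \<Rightarrow> 'k) set \<Rightarrow> 'k) set"
  where "tensor_assoc K A B D =
    (let Z = tensor K A (tensor K B D) in
      tensor_lift K Z (\<lambda>t d.
        tensor_lift K Z (\<lambda>a b. pure_tensor K A (tensor K B D) a (pure_tensor K B D b d)) t))"


section \<open>Well-definedness of the tensor product\<close>

lemma linear_maps_zero:
  assumes "module K A" "module K B" "f \<in> linear_maps K A B"
  shows "f \<zero>\<^bsub>A\<^esub> = \<zero>\<^bsub>B\<^esub>"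
proof -
  interpret A: module K A by fact
  interpret B: module K B by fact
  have "f \<zero>\<^bsub>A\<^esub> \<in> carrier B" "f (\<zero>\<^bsub>K\<^esub> \<odot>\<^bsub>A\<^esub> \<zero>\<^bsub>A\<^esub>) = \<zero>\<^bsub>K\<^esub> \<odot>\<^bsub>B\<^esub> f \<zero>\<^bsub>A\<^esub>"
    using assms(3) unfolding linear_maps_def by (blast intro: A.M.zero_closed A.R.zero_closed)+
  then show ?thesis by simp
qed

lemma module_minus_eq_smult:
  assumes "module K A" "x \<in> carrier A"
  shows "\<ominus>\<^bsub>A\<^esub> x = (\<ominus>\<^bsub>K\<^esub> \<one>\<^bsub>K\<^esub>) \<odot>\<^bsub>A\<^esub> x"
proof -
  interpret A: module K A by fact
  show ?thesis using assms(2) A.smult_l_minus[of "\<one>\<^bsub>K\<^esub>" x] by simp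
qed

lemma linear_maps_minus:
  assumes "module K A" "module K B" "f \<in> linear_maps K A B" "x \<in> carrier A" "y \<in> carrier A"
  shows "f (x \<ominus>\<^bsub>A\<^esub> y) = f x \<ominus>\<^bsub>B\<^esub> f y"
proof -
  interpret A: module K A by fact
  interpret B: module K B by fact
  have "f x \<in> carrier B" "f y \<in> carrier B" using assms unfolding linear_maps_def by auto
  then show ?thesis
    using assms(3-5) unfolding a_minus_def linear_maps_def
    by (simp add: module_minus_eq_smult[OF assms(1)] module_minus_eq_smult[OF assms(2)])
qed

lemma ring_as_module_module:
  assumes "cring K" shows "module K (ring_as_module K)"
proof -
  interpret cring K by fact
  show ?thesis
    by (intro moduleI abelian_groupI assms)
       (auto simp: ring_as_module_def a_ac m_assoc l_distr r_distr r_neg l_neg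
             intro!: bexI[of _ "\<ominus>\<^bsub>K\<^esub> x" for x])
qed

lemma free_module_closed:
  assumes "cring K" "x \<in> carrier (free_module K S)"
  shows "x s \<in> carrier K"
proof -
  interpret cring K by fact
  show ?thesis using assms(2) by (cases "s \<in> S") (auto simp: free_module_def)
qed

lemma free_module_module:
  assumes "cring K" shows "module K (free_module K S)"
proof -
  interpret cring K by fact
  have fin_add: "finite {s. x s \<oplus>\<^bsub>K\<^esub> y s \<noteq> \<zero>\<^bsub>K\<^esub>}"
    if "finite {s. x s \<noteq> \<zero>\<^bsub>K\<^esub>}" "finite {s. y s \<noteq> \<zero>\<^bsub>K\<^esub>}" for x y :: "_ \<Rightarrow> 'a"
    by (rule finite_subset[OF _ finite_UnI[OF that]]) auto
  have fin_smult: "finite {s. r \<otimes>\<^bsub>K\<^esub> x s \<noteq> \<zero>\<^bsub>K\<^esub>}"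
    if "finite {s. x s \<noteq> \<zero>\<^bsub>K\<^esub>}" "r \<in> carrier K" for x :: "_ \<Rightarrow> 'a" and r
    by (rule finite_subset[OF _ that(1)]) (use that(2) in auto)
  have fin_minus: "finite {s. \<ominus>\<^bsub>K\<^esub> x s \<noteq> \<zero>\<^bsub>K\<^esub>}"
    if "finite {s. x s \<noteq> \<zero>\<^bsub>K\<^esub>}" for x :: "_ \<Rightarrow> 'a"
    by (rule finite_subset[OF _ that]) auto
  let ?F = "free_module K S"
  note c = free_module_closed[OF assms, of _ S]
  have ops: "(x \<oplus>\<^bsub>?F\<^esub> y) s = x s \<oplus>\<^bsub>K\<^esub> y s" "(r \<odot>\<^bsub>?F\<^esub> x) s = r \<otimes>\<^bsub>K\<^esub> x s" "\<zero>\<^bsub>?F\<^esub> s = \<zero>\<^bsub>K\<^esub>"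
    for x y s r by (simp_all add: free_module_def)
  have mem: "x \<oplus>\<^bsub>?F\<^esub> y \<in> carrier ?F" "\<zero>\<^bsub>?F\<^esub> \<in> carrier ?F"
    if "x \<in> carrier ?F" "y \<in> carrier ?F" for x y
    using that by (simp_all add: free_module_def fin_add)
  have zmem: "\<zero>\<^bsub>?F\<^esub> \<in> carrier ?F" by (simp add: free_module_def)
  have smem: "r \<odot>\<^bsub>?F\<^esub> x \<in> carrier ?F"
    if "x \<in> carrier ?F" "r \<in> carrier K" for x r
    using that by (simp add: free_module_def fin_smult)
  have inv: "\<exists>y\<in>carrier ?F. y \<oplus>\<^bsub>?F\<^esub> x = \<zero>\<^bsub>?F\<^esub>" if x: "x \<in> carrier ?F" for x
  proof (rule bexI[of _ "\<lambda>s. \<ominus>\<^bsub>K\<^esub> x s"])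
    show "(\<lambda>s. \<ominus>\<^bsub>K\<^esub> x s) \<in> carrier ?F"
      using x by (auto simp: free_module_def fin_minus)
  qed (use c[OF x] in \<open>auto simp: fun_eq_iff ops l_neg\<close>)
  show ?thesis
    by (rule moduleI[OF assms abelian_groupI])
       (simp add: mem zmem smem inv | rule ext, simp add: ops c a_ac m_assoc l_distr r_distr)+
qed

lemma free_gen_closed:
  assumes "cring K" "s \<in> S" shows "free_gen K s \<in> carrier (free_module K S)"
proof -
  interpret cring K by fact
  have "finite {t. free_gen K s t \<noteq> \<zero>\<^bsub>K\<^esub>}"
    by (rule finite_subset[of _ "{s}"]) (auto simp: free_gen_def)
  then show ?thesis using assms(2) by (auto simp: free_module_def free_gen_def)
qed

lemma submodule_span_submodule:
  assumes "module K F" "X \<subseteq> carrier F"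
  shows "submodule (submodule_span K F X) K F" "X \<subseteq> submodule_span K F X"
proof -
  interpret module K F by fact
  have X: "carrier F \<in> {N. submodule N K F \<and> X \<subseteq> N}"
    using assms(2) carrier_is_submodule by auto
  have zero: "\<zero>\<^bsub>F\<^esub> \<in> N" if "submodule N K F" for N
    using subgroup.one_closed[OF submodule.axioms(1)[OF that]] by simp
  show "submodule (submodule_span K F X) K F" unfolding submodule_span_def
  proof (rule submoduleI)
    show "\<Inter>{N. submodule N K F \<and> X \<subseteq> N} \<subseteq> carrier F" using X by blast
    show "\<zero>\<^bsub>F\<^esub> \<in> \<Inter>{N. submodule N K F \<and> X \<subseteq> N}" using zero by blast
  qed (simp_all add: submoduleE(3-5))
  show "X \<subseteq> submodule_span K F X" unfolding submodule_span_def by blast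
qed

lemma submodule_abelian_subgroup:
  assumes "module K F" "submodule N K F" shows "abelian_subgroup N F"
  using assms module.axioms(2) submodule.axioms(1)
  by (intro abelian_subgroupI3 additive_subgroup.intro) auto

lemma quotient_module_ops:
  assumes "module K F" "submodule N K F" "x \<in> carrier F"
  shows "y \<in> carrier F \<Longrightarrow>
      (N +>\<^bsub>F\<^esub> x) \<oplus>\<^bsub>quotient_module K F N\<^esub> (N +>\<^bsub>F\<^esub> y) = N +>\<^bsub>F\<^esub> (x \<oplus>\<^bsub>F\<^esub> y)"
    and "r \<in> carrier K \<Longrightarrow> r \<odot>\<^bsub>quotient_module K F N\<^esub> (N +>\<^bsub>F\<^esub> x) = N +>\<^bsub>F\<^esub> (r \<odot>\<^bsub>F\<^esub> x)"
proof -
  interpret module K F by fact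
  interpret N: abelian_subgroup N F by (rule submodule_abelian_subgroup[OF assms(1,2)])
  show "(N +>\<^bsub>F\<^esub> x) \<oplus>\<^bsub>quotient_module K F N\<^esub> (N +>\<^bsub>F\<^esub> y) = N +>\<^bsub>F\<^esub> (x \<oplus>\<^bsub>F\<^esub> y)"
    if "y \<in> carrier F"
    using that assms(3) by (simp add: quotient_module_def N.a_rcos_sum)
  assume r: "r \<in> carrier K"
  have eq: "N +>\<^bsub>F\<^esub> (r \<odot>\<^bsub>F\<^esub> z) = N +>\<^bsub>F\<^esub> (r \<odot>\<^bsub>F\<^esub> x)" if z: "z \<in> N +>\<^bsub>F\<^esub> x" for z
  proof -
    obtain n where n: "n \<in> N" "z = n \<oplus>\<^bsub>F\<^esub> x" using z unfolding a_r_coset_def' by auto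
    then have "r \<odot>\<^bsub>F\<^esub> z = r \<odot>\<^bsub>F\<^esub> n \<oplus>\<^bsub>F\<^esub> r \<odot>\<^bsub>F\<^esub> x"
      using r assms(3) N.a_Hcarr by (simp add: smult_r_distr)
    moreover have "r \<odot>\<^bsub>F\<^esub> n \<in> N" using submodule.smult_closed[OF assms(2) r n(1)] .
    ultimately have "r \<odot>\<^bsub>F\<^esub> z \<in> N +>\<^bsub>F\<^esub> (r \<odot>\<^bsub>F\<^esub> x)" unfolding a_r_coset_def' by auto
    then show ?thesis
      using M.a_repr_independence[OF _ _ N.a_subgroup, of "r \<odot>\<^bsub>F\<^esub> z" "r \<odot>\<^bsub>F\<^esub> x"] r assms(3) by simp
  qed
  have "(\<Union>z\<in>N +>\<^bsub>F\<^esub> x. N +>\<^bsub>F\<^esub> (r \<odot>\<^bsub>F\<^esub> z)) = (\<Union>z\<in>N +>\<^bsub>F\<^esub> x. N +>\<^bsub>F\<^esub> (r \<odot>\<^bsub>F\<^esub> x))"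
    by (rule SUP_cong[OF refl eq])
  also have "\<dots> = N +>\<^bsub>F\<^esub> (r \<odot>\<^bsub>F\<^esub> x)"
    using N.a_rcos_self[OF assms(3)] by (intro SUP_eq_const) auto
  finally show "r \<odot>\<^bsub>quotient_module K F N\<^esub> (N +>\<^bsub>F\<^esub> x) = N +>\<^bsub>F\<^esub> (r \<odot>\<^bsub>F\<^esub> x)"
    by (simp add: quotient_module_def)
qed

lemma quotient_module_module:
  assumes "module K F" "submodule N K F"
  shows "module K (quotient_module K F N)"
proof -
  interpret module K F by fact
  interpret N: abelian_subgroup N F by (rule submodule_abelian_subgroup[OF assms(1,2)])
  let ?Q = "quotient_module K F N"
  note ops = quotient_module_ops[OF assms]
  have car: "X \<in> carrier ?Q \<longleftrightarrow> (\<exists>x\<in>carrier F. X = N +>\<^bsub>F\<^esub> x)" for X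
    unfolding quotient_module_def A_RCOSETS_def' by auto
  have carE: thesis if "X \<in> carrier ?Q" "\<And>x. x \<in> carrier F \<Longrightarrow> X = N +>\<^bsub>F\<^esub> x \<Longrightarrow> thesis"
    for X thesis using that car by blast
  have zer: "\<zero>\<^bsub>?Q\<^esub> = N +>\<^bsub>F\<^esub> \<zero>\<^bsub>F\<^esub>"
    using N.a_subset by (simp add: quotient_module_def)
  have mem: "N +>\<^bsub>F\<^esub> x \<in> carrier ?Q" if "x \<in> carrier F" for x
    using that car by blast
  show ?thesis
  proof (rule moduleI[OF is_cring abelian_groupI])
    fix X assume "X \<in> carrier ?Q"
    then obtain x where x: "x \<in> carrier F" "X = N +>\<^bsub>F\<^esub> x" using car by blast
    show "\<exists>Y\<in>carrier ?Q. Y \<oplus>\<^bsub>?Q\<^esub> X = \<zero>\<^bsub>?Q\<^esub>"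
      by (rule bexI[of _ "N +>\<^bsub>F\<^esub> (\<ominus>\<^bsub>F\<^esub> x)"])
         (use x in \<open>simp_all add: ops zer mem M.l_neg\<close>)
  next
    fix X Y Z assume "X \<in> carrier ?Q" "Y \<in> carrier ?Q" "Z \<in> carrier ?Q"
    then show "X \<oplus>\<^bsub>?Q\<^esub> Y \<oplus>\<^bsub>?Q\<^esub> Z = X \<oplus>\<^bsub>?Q\<^esub> (Y \<oplus>\<^bsub>?Q\<^esub> Z)"
      by (elim carE) (simp add: ops M.a_assoc)
  next
    fix X Y assume "X \<in> carrier ?Q" "Y \<in> carrier ?Q"
    then show "X \<oplus>\<^bsub>?Q\<^esub> Y = Y \<oplus>\<^bsub>?Q\<^esub> X"
      by (elim carE) (simp add: ops M.a_comm)
  qed (elim carE; simp add: zer ops mem smult_l_distr smult_r_distr smult_assoc1; fail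
        | simp add: zer mem)+
qed

lemma tensor_relations_carrier:
  assumes "module K A" "module K B"
  shows "tensor_relations K A B \<subseteq> carrier (free_module K (carrier A \<times> carrier B))"
proof -
  interpret A: module K A by fact
  interpret B: module K B by fact
  interpret F: module K "free_module K (carrier A \<times> carrier B)"
    using A.R.is_cring by (rule free_module_module)
  show ?thesis
    using free_gen_closed[OF A.R.is_cring, of _ "carrier A \<times> carrier B"]
    by (auto simp: tensor_relations_def Let_def)
qed

lemma tensor_kernel_submodule:
  assumes "module K A" "module K B"
  shows "submodule (tensor_kernel K A B) K (free_module K (carrier A \<times> carrier B))"
  unfolding tensor_kernel_def
  by (rule submodule_span_submodule(1)[OF free_module_module[OF module.axioms(1)[OF assms(1)]]
        tensor_relations_carrier[OF assms]])

lemma tensor_module: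
  assumes "module K A" "module K B" shows "module K (tensor K A B)"
  unfolding tensor_def
  by (rule quotient_module_module[OF free_module_module[OF module.axioms(1)[OF assms(1)]]
        tensor_kernel_submodule[OF assms]])

lemma bilinear_mapsD:
  assumes "\<beta> \<in> bilinear_maps K A B D" "a \<in> carrier A" "b \<in> carrier B"
  shows "\<beta> a b \<in> carrier D"
    and "a' \<in> carrier A \<Longrightarrow> \<beta> (a \<oplus>\<^bsub>A\<^esub> a') b = \<beta> a b \<oplus>\<^bsub>D\<^esub> \<beta> a' b"
    and "b' \<in> carrier B \<Longrightarrow> \<beta> a (b \<oplus>\<^bsub>B\<^esub> b') = \<beta> a b \<oplus>\<^bsub>D\<^esub> \<beta> a b'"
    and "r \<in> carrier K \<Longrightarrow> \<beta> (r \<odot>\<^bsub>A\<^esub> a) b = r \<odot>\<^bsub>D\<^esub> \<beta> a b"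
    and "r \<in> carrier K \<Longrightarrow> \<beta> a (r \<odot>\<^bsub>B\<^esub> b) = r \<odot>\<^bsub>D\<^esub> \<beta> a b"
  using assms unfolding bilinear_maps_def linear_maps_def by (blast dest: funcset_mem)+

lemma bilinear_eval_linear:
  fixes A :: "('k, 'a, 'x) module_scheme" and B :: "('k, 'b, 'y) module_scheme"
  assumes "module K A" "module K B" "module K D" "\<beta> \<in> bilinear_maps K A B D"
  defines "ev \<equiv> \<lambda>x. \<Oplus>\<^bsub>D\<^esub>p\<in>{p. x p \<noteq> \<zero>\<^bsub>K\<^esub>}. x p \<odot>\<^bsub>D\<^esub> \<beta> (fst p) (snd p)"
  shows "ev \<in> linear_maps K (free_module K (carrier A \<times> carrier B)) D"
    and "a \<in> carrier A \<Longrightarrow> b \<in> carrier B \<Longrightarrow> ev (free_gen K (a, b)) = \<beta> a b"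
proof -
  interpret D: module K D by fact
  have cr: "cring K" using assms(1) by (rule module.axioms(1))
  let ?S = "carrier A \<times> carrier B"
  let ?F = "free_module K ?S"
  interpret F: module K ?F using cr by (rule free_module_module)
  have \<beta>: "\<beta> (fst p) (snd p) \<in> carrier D" if "p \<in> ?S" for p
    using that bilinear_mapsD(1)[OF assms(4)] by auto
  note cl = free_module_closed[OF cr]
  have fin: "finite {p. x p \<noteq> \<zero>\<^bsub>K\<^esub>}" and sub: "{p. x p \<noteq> \<zero>\<^bsub>K\<^esub>} \<subseteq> ?S" if "x \<in> carrier ?F" for x
    using that by (auto simp: free_module_def)
  have ops: "(x \<oplus>\<^bsub>?F\<^esub> y) s = x s \<oplus>\<^bsub>K\<^esub> y s" "(r \<odot>\<^bsub>?F\<^esub> x) s = r \<otimes>\<^bsub>K\<^esub> x s" for x y s r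
    by (simp_all add: free_module_def)
  have ev: "ev x = (\<Oplus>\<^bsub>D\<^esub>p\<in>U. x p \<odot>\<^bsub>D\<^esub> \<beta> (fst p) (snd p))"
    if "x \<in> carrier ?F" "finite U" "{p. x p \<noteq> \<zero>\<^bsub>K\<^esub>} \<subseteq> U" "U \<subseteq> ?S" for x U
    unfolding ev_def
    by (rule D.add.finprod_mono_neutral_cong_left) (use that \<beta> cl[OF that(1)] in auto)
  have evc: "ev x \<in> carrier D" if "x \<in> carrier ?F" for x
    unfolding ev_def by (rule D.M.finsum_closed) (use sub[OF that] \<beta> cl[OF that] in auto)
  have eva: "ev (x \<oplus>\<^bsub>?F\<^esub> y) = ev x \<oplus>\<^bsub>D\<^esub> ev y" if "x \<in> carrier ?F" "y \<in> carrier ?F" for x y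
  proof -
    let ?U = "{p. x p \<noteq> \<zero>\<^bsub>K\<^esub>} \<union> {p. y p \<noteq> \<zero>\<^bsub>K\<^esub>}"
    have U: "finite ?U" "?U \<subseteq> ?S" using fin sub that by auto
    have m: "p \<in> ?U \<Longrightarrow> \<beta> (fst p) (snd p) \<in> carrier D" for p using U(2) \<beta> by blast
    have "ev (x \<oplus>\<^bsub>?F\<^esub> y) = (\<Oplus>\<^bsub>D\<^esub>p\<in>?U. (x \<oplus>\<^bsub>?F\<^esub> y) p \<odot>\<^bsub>D\<^esub> \<beta> (fst p) (snd p))"
      by (rule ev) (use that U ops in auto)
    also have "\<dots> = (\<Oplus>\<^bsub>D\<^esub>p\<in>?U. x p \<odot>\<^bsub>D\<^esub> \<beta> (fst p) (snd p) \<oplus>\<^bsub>D\<^esub> y p \<odot>\<^bsub>D\<^esub> \<beta> (fst p) (snd p))"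
      by (rule D.M.finsum_cong'[OF refl])
         (use m cl[OF that(1)] cl[OF that(2)] in \<open>auto simp: ops D.smult_l_distr\<close>)
    also have "\<dots> = (\<Oplus>\<^bsub>D\<^esub>p\<in>?U. x p \<odot>\<^bsub>D\<^esub> \<beta> (fst p) (snd p)) \<oplus>\<^bsub>D\<^esub>
                    (\<Oplus>\<^bsub>D\<^esub>p\<in>?U. y p \<odot>\<^bsub>D\<^esub> \<beta> (fst p) (snd p))"
      by (rule D.M.finsum_addf) (use m cl[OF that(1)] cl[OF that(2)] in auto)
    also have "\<dots> = ev x \<oplus>\<^bsub>D\<^esub> ev y"
      using ev[OF that(1) U(1) _ U(2)] ev[OF that(2) U(1) _ U(2)] by simp
    finally show ?thesis .
  qed
  have evs: "ev (r \<odot>\<^bsub>?F\<^esub> x) = r \<odot>\<^bsub>D\<^esub> ev x" if "r \<in> carrier K" "x \<in> carrier ?F" for r x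
  proof -
    let ?U = "{p. x p \<noteq> \<zero>\<^bsub>K\<^esub>}"
    have m: "p \<in> ?U \<Longrightarrow> \<beta> (fst p) (snd p) \<in> carrier D" for p using sub[OF that(2)] \<beta> by blast
    have "ev (r \<odot>\<^bsub>?F\<^esub> x) = (\<Oplus>\<^bsub>D\<^esub>p\<in>?U. (r \<odot>\<^bsub>?F\<^esub> x) p \<odot>\<^bsub>D\<^esub> \<beta> (fst p) (snd p))"
      by (rule ev) (use that fin[OF that(2)] sub[OF that(2)] ops in auto)
    also have "\<dots> = (\<Oplus>\<^bsub>D\<^esub>p\<in>?U. r \<odot>\<^bsub>D\<^esub> (x p \<odot>\<^bsub>D\<^esub> \<beta> (fst p) (snd p)))"
      by (rule D.M.finsum_cong'[OF refl])
         (use m that(1) cl[OF that(2)] in \<open>auto simp: ops D.smult_assoc1\<close>)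
    also have "\<dots> = r \<odot>\<^bsub>D\<^esub> ev x"
      unfolding ev_def
      by (rule D.finsum_smult_ldistr[symmetric]) (use m fin that cl[OF that(2)] in auto)
    finally show ?thesis .
  qed
  show "ev \<in> linear_maps K ?F D"
    unfolding linear_maps_def using evc eva evs by blast
  assume ab: "a \<in> carrier A" "b \<in> carrier B"
  have "ev (free_gen K (a, b)) = (\<Oplus>\<^bsub>D\<^esub>p\<in>{(a, b)}. free_gen K (a, b) p \<odot>\<^bsub>D\<^esub> \<beta> (fst p) (snd p))"
    by (rule ev) (use ab free_gen_closed[OF cr, of "(a, b)" ?S] in \<open>auto simp: free_gen_def\<close>)
  also have "\<dots> = \<beta> a b" using \<beta>[of "(a, b)"] ab by (simp add: free_gen_def)
  finally show "ev (free_gen K (a, b)) = \<beta> a b" .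
qed

lemma linear_kernel_submodule:
  assumes "module K A" "module K B" "f \<in> linear_maps K A B"
  shows "submodule {x \<in> carrier A. f x = \<zero>\<^bsub>B\<^esub>} K A"
proof -
  interpret A: module K A by fact
  interpret B: module K B by fact
  note f = assms(3)[unfolded linear_maps_def, simplified]
  have neg: "f (\<ominus>\<^bsub>A\<^esub> x) = (\<ominus>\<^bsub>K\<^esub> \<one>\<^bsub>K\<^esub>) \<odot>\<^bsub>B\<^esub> f x" if "x \<in> carrier A" for x
    using that f by (simp add: module_minus_eq_smult[OF assms(1)])
  show ?thesis
    by (rule A.submoduleI) (use f linear_maps_zero[OF assms] neg in auto)
qed

text \<open>The universal property of \<open>A \<otimes> B\<close>.\<close>

lemma tensor_lift_coset:
  assumes "module K A" "module K B" "module K D" "\<beta> \<in> bilinear_maps K A B D"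
    and x: "x \<in> carrier (free_module K (carrier A \<times> carrier B))"
  shows "tensor_lift K D \<beta> (tensor_kernel K A B +>\<^bsub>free_module K (carrier A \<times> carrier B)\<^esub> x) =
    (\<Oplus>\<^bsub>D\<^esub>p\<in>{p. x p \<noteq> \<zero>\<^bsub>K\<^esub>}. x p \<odot>\<^bsub>D\<^esub> \<beta> (fst p) (snd p))"
proof -
  interpret A: module K A by fact
  interpret B: module K B by fact
  interpret D: module K D by fact
  have cr: "cring K" using assms(1) by (rule module.axioms(1))
  let ?S = "carrier A \<times> carrier B"
  let ?F = "free_module K ?S"
  let ?N = "tensor_kernel K A B"
  define ev where "ev = (\<lambda>x. \<Oplus>\<^bsub>D\<^esub>p\<in>{p. x p \<noteq> \<zero>\<^bsub>K\<^esub>}. x p \<odot>\<^bsub>D\<^esub> \<beta> (fst p) (snd p))"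
  have modF: "module K ?F" using cr by (rule free_module_module)
  interpret F: module K ?F by (rule modF)
  interpret N: abelian_subgroup ?N ?F
    by (rule submodule_abelian_subgroup[OF modF tensor_kernel_submodule[OF assms(1,2)]])
  have evF: "ev \<in> linear_maps K ?F D"
    unfolding ev_def by (rule bilinear_eval_linear(1)[OF assms(1-4)])
  have evg: "ev (free_gen K (a, b)) = \<beta> a b" if "a \<in> carrier A" "b \<in> carrier B" for a b
    unfolding ev_def by (rule bilinear_eval_linear(2)[OF assms(1-4) that])
  note evl = evF[unfolded linear_maps_def, simplified]
  note evm = linear_maps_minus[OF modF assms(3) evF]
  have g: "free_gen K (a, b) \<in> carrier ?F" if "a \<in> carrier A" "b \<in> carrier B" for a b
    using that by (auto intro: free_gen_closed[OF cr])
  have dz: "d \<ominus>\<^bsub>D\<^esub> d = \<zero>\<^bsub>D\<^esub>" if "d \<in> carrier D" for d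
    using that by (simp add: a_minus_def D.M.r_neg)
  have "ev y = \<zero>\<^bsub>D\<^esub>" if "y \<in> tensor_relations K A B" for y
    using that unfolding tensor_relations_def Let_def
    by (auto simp: evm evl g evg bilinear_mapsD[OF assms(4)] dz)
  then have "tensor_relations K A B \<subseteq> {y \<in> carrier ?F. ev y = \<zero>\<^bsub>D\<^esub>}"
    using tensor_relations_carrier[OF assms(1,2)] by blast
  then have ker: "?N \<subseteq> {y \<in> carrier ?F. ev y = \<zero>\<^bsub>D\<^esub>}"
    unfolding tensor_kernel_def submodule_span_def
    by (intro Inter_lower CollectI conjI linear_kernel_submodule[OF modF assms(3) evF])
  have indep: "ev z = ev x" if z: "z \<in> ?N +>\<^bsub>?F\<^esub> x" for z
  proof -
    obtain n where n: "n \<in> ?N" "z = n \<oplus>\<^bsub>?F\<^esub> x" using z unfolding a_r_coset_def' by auto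
    have "ev z = ev n \<oplus>\<^bsub>D\<^esub> ev x" unfolding n(2) using evl N.a_Hcarr[OF n(1)] x by simp
    moreover have "ev n = \<zero>\<^bsub>D\<^esub>" using n(1) ker by blast
    moreover have "ev x \<in> carrier D" using evl x by blast
    ultimately show ?thesis by simp
  qed
  have "(SOME z. z \<in> ?N +>\<^bsub>?F\<^esub> x) \<in> ?N +>\<^bsub>?F\<^esub> x"
    by (rule someI[of "\<lambda>z. z \<in> ?N +>\<^bsub>?F\<^esub> x", OF N.a_rcos_self[OF x]])
  then have "ev (SOME z. z \<in> ?N +>\<^bsub>?F\<^esub> x) = ev x" by (rule indep)
  then show ?thesis by (simp add: tensor_lift_def ev_def Let_def)
qed

lemma tensor_lift_pure:
  assumes "module K A" "module K B" "module K D" "\<beta> \<in> bilinear_maps K A B D"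
    and "a \<in> carrier A" "b \<in> carrier B"
  shows "tensor_lift K D \<beta> (pure_tensor K A B a b) = \<beta> a b"
  unfolding pure_tensor_def
  using bilinear_eval_linear(2)[OF assms] free_gen_closed[OF module.axioms(1)[OF assms(1)], of "(a, b)" "carrier A \<times> carrier B"] assms(5,6)
  by (subst tensor_lift_coset[OF assms(1-4)]) auto

lemma tensor_carrier_iff:
  "X \<in> carrier (tensor K A B) \<longleftrightarrow>
    (\<exists>x\<in>carrier (free_module K (carrier A \<times> carrier B)).
       X = tensor_kernel K A B +>\<^bsub>free_module K (carrier A \<times> carrier B)\<^esub> x)"
  unfolding tensor_def quotient_module_def A_RCOSETS_def' by auto

lemma tensor_lift_linear:
  assumes "module K A" "module K B" "module K D" "\<beta> \<in> bilinear_maps K A B D"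
  shows "tensor_lift K D \<beta> \<in> linear_maps K (tensor K A B) D"
proof -
  let ?F = "free_module K (carrier A \<times> carrier B)"
  let ?N = "tensor_kernel K A B"
  have modF: "module K ?F" using module.axioms(1)[OF assms(1)] by (rule free_module_module)
  interpret F: module K ?F by (rule modF)
  note lin = bilinear_eval_linear(1)[OF assms, unfolded linear_maps_def, simplified]
  note lift = tensor_lift_coset[OF assms]
  note ops = quotient_module_ops[OF modF tensor_kernel_submodule[OF assms(1,2)], folded tensor_def]
  show ?thesis
    unfolding linear_maps_def
  proof (intro CollectI conjI ballI funcsetI)
    fix X assume "X \<in> carrier (tensor K A B)"
    then obtain x where x: "x \<in> carrier ?F" "X = ?N +>\<^bsub>?F\<^esub> x" unfolding tensor_carrier_iff by blast
    show "tensor_lift K D \<beta> X \<in> carrier D" using x(1) lin unfolding x(2) lift[OF x(1)] by auto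
    {
      fix r assume r: "r \<in> carrier K"
      have rx: "r \<odot>\<^bsub>?F\<^esub> x \<in> carrier ?F" using r x(1) by simp
      show "tensor_lift K D \<beta> (r \<odot>\<^bsub>tensor K A B\<^esub> X) = r \<odot>\<^bsub>D\<^esub> tensor_lift K D \<beta> X"
        unfolding x(2) ops(2)[OF x(1) r] lift[OF rx] lift[OF x(1)] using lin r x(1) by simp
    }
    fix Y assume "Y \<in> carrier (tensor K A B)"
    then obtain y where y: "y \<in> carrier ?F" "Y = ?N +>\<^bsub>?F\<^esub> y" unfolding tensor_carrier_iff by blast
    have xy: "x \<oplus>\<^bsub>?F\<^esub> y \<in> carrier ?F" using y(1) x(1) by simp
    show "tensor_lift K D \<beta> (X \<oplus>\<^bsub>tensor K A B\<^esub> Y) = tensor_lift K D \<beta> X \<oplus>\<^bsub>D\<^esub> tensor_lift K D \<beta> Y"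
      unfolding x(2) y(2) ops(1)[OF x(1) y(1)] lift[OF xy] lift[OF x(1)] lift[OF y(1)]
      using lin y(1) x(1) by simp
  qed
qed

lemma pure_tensor_bilinear:
  assumes "module K A" "module K B"
  shows "pure_tensor K A B \<in> bilinear_maps K A B (tensor K A B)"
proof -
  interpret A: module K A by fact
  interpret B: module K B by fact
  have cr: "cring K" using assms(1) by (rule module.axioms(1))
  let ?F = "free_module K (carrier A \<times> carrier B)"
  let ?N = "tensor_kernel K A B"
  have modF: "module K ?F" using cr by (rule free_module_module)
  interpret F: module K ?F by (rule modF)
  note sub = tensor_kernel_submodule[OF assms]
  interpret N: abelian_subgroup ?N ?F by (rule submodule_abelian_subgroup[OF modF sub])
  note ops = quotient_module_ops[OF modF sub, folded tensor_def]
  have g: "free_gen K (a, b) \<in> carrier ?F" if "a \<in> carrier A" "b \<in> carrier B" for a b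
    using that by (auto intro: free_gen_closed[OF cr])
  have rel: "tensor_relations K A B \<subseteq> ?N"
    unfolding tensor_kernel_def by (rule submodule_span_submodule(2)[OF modF tensor_relations_carrier[OF assms]])
  have eq: "?N +>\<^bsub>?F\<^esub> x = ?N +>\<^bsub>?F\<^esub> y"
    if "x \<ominus>\<^bsub>?F\<^esub> y \<in> tensor_relations K A B" "x \<in> carrier ?F" "y \<in> carrier ?F" for x y
  proof -
    have "x \<in> ?N +>\<^bsub>?F\<^esub> y"
      using that rel N.a_rcos_module[of y x] by (auto simp: a_minus_def)
    then show ?thesis using F.M.a_repr_independence[OF _ that(3) N.a_subgroup] by simp
  qed
  have carr: "pure_tensor K A B a b \<in> carrier (tensor K A B)" if "a \<in> carrier A" "b \<in> carrier B" for a b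
    using g[OF that] unfolding tensor_carrier_iff pure_tensor_def by blast
  have addl: "pure_tensor K A B (a \<oplus>\<^bsub>A\<^esub> a') b = pure_tensor K A B a b \<oplus>\<^bsub>tensor K A B\<^esub> pure_tensor K A B a' b"
    if "a \<in> carrier A" "a' \<in> carrier A" "b \<in> carrier B" for a a' b
    unfolding pure_tensor_def ops(1)[OF g[OF that(1,3)] g[OF that(2,3)]]
    by (rule eq) (use that g in \<open>auto simp: tensor_relations_def Let_def\<close>)
  have addr: "pure_tensor K A B a (b \<oplus>\<^bsub>B\<^esub> b') = pure_tensor K A B a b \<oplus>\<^bsub>tensor K A B\<^esub> pure_tensor K A B a b'"
    if "a \<in> carrier A" "b \<in> carrier B" "b' \<in> carrier B" for a b b'
    unfolding pure_tensor_def ops(1)[OF g[OF that(1,2)] g[OF that(1,3)]]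
    by (rule eq) (use that g in \<open>auto simp: tensor_relations_def Let_def\<close>)
  have sl: "pure_tensor K A B (r \<odot>\<^bsub>A\<^esub> a) b = r \<odot>\<^bsub>tensor K A B\<^esub> pure_tensor K A B a b"
    if "r \<in> carrier K" "a \<in> carrier A" "b \<in> carrier B" for r a b
    unfolding pure_tensor_def ops(2)[OF g[OF that(2,3)] that(1)]
    by (rule eq) (use that g in \<open>auto simp: tensor_relations_def Let_def\<close>)
  have sr: "pure_tensor K A B a (r \<odot>\<^bsub>B\<^esub> b) = r \<odot>\<^bsub>tensor K A B\<^esub> pure_tensor K A B a b"
    if "r \<in> carrier K" "a \<in> carrier A" "b \<in> carrier B" for r a b
    unfolding pure_tensor_def ops(2)[OF g[OF that(2,3)] that(1)]
    by (rule eq) (use that g in \<open>auto simp: tensor_relations_def Let_def\<close>)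
  show ?thesis
    unfolding bilinear_maps_def linear_maps_def using carr addl addr sl sr by auto
qed

lemma linear_mapsD:
  assumes "f \<in> linear_maps K A B" "x \<in> carrier A"
  shows "f x \<in> carrier B"
    and "y \<in> carrier A \<Longrightarrow> f (x \<oplus>\<^bsub>A\<^esub> y) = f x \<oplus>\<^bsub>B\<^esub> f y"
    and "r \<in> carrier K \<Longrightarrow> f (r \<odot>\<^bsub>A\<^esub> x) = r \<odot>\<^bsub>B\<^esub> f x"
  using assms unfolding linear_maps_def by (blast dest: funcset_mem)+

lemma tensor_map_bilinear:
  assumes "module K A" "module K B" "module K A'" "module K B'"
    and "f \<in> linear_maps K A A'" "g \<in> linear_maps K B B'"
  shows "(\<lambda>a b. pure_tensor K A' B' (f a) (g b)) \<in> bilinear_maps K A B (tensor K A' B')"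
  unfolding bilinear_maps_def linear_maps_def
  using linear_mapsD[OF assms(5)] linear_mapsD[OF assms(6)]
    bilinear_mapsD[OF pure_tensor_bilinear[OF assms(3,4)]]
  by auto

lemma tensor_map_linear:
  assumes "module K A" "module K B" "module K A'" "module K B'"
    and "f \<in> linear_maps K A A'" "g \<in> linear_maps K B B'"
  shows "tensor_map K A' B' f g \<in> linear_maps K (tensor K A B) (tensor K A' B')"
  unfolding tensor_map_def
  by (rule tensor_lift_linear[OF assms(1,2) tensor_module[OF assms(3,4)] tensor_map_bilinear[OF assms]])

lemma tensor_map_pure:
  assumes "module K A" "module K B" "module K A'" "module K B'"
    and "f \<in> linear_maps K A A'" "g \<in> linear_maps K B B'"
    and "a \<in> carrier A" "b \<in> carrier B"
  shows "tensor_map K A' B' f g (pure_tensor K A B a b) = pure_tensor K A' B' (f a) (g b)"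
  unfolding tensor_map_def
  by (rule tensor_lift_pure[OF assms(1,2) tensor_module[OF assms(3,4)]
        tensor_map_bilinear[OF assms(1-6)] assms(7,8)])

lemma tensor_lift_linear_param:
  assumes "module K A" "module K B" "module K D" "module K Z"
    and \<gamma>: "\<And>d. d \<in> carrier D \<Longrightarrow> \<gamma> d \<in> bilinear_maps K A B Z"
    and \<gamma>d: "\<And>a b. a \<in> carrier A \<Longrightarrow> b \<in> carrier B \<Longrightarrow> (\<lambda>d. \<gamma> d a b) \<in> linear_maps K D Z"
    and t: "t \<in> carrier (tensor K A B)"
  shows "(\<lambda>d. tensor_lift K Z (\<gamma> d) t) \<in> linear_maps K D Z"
proof -
  interpret D: module K D by fact
  interpret Z: module K Z by fact
  have cr: "cring K" using assms(1) by (rule module.axioms(1))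
  let ?S = "carrier A \<times> carrier B"
  let ?F = "free_module K ?S"
  obtain x where x: "x \<in> carrier ?F" "t = tensor_kernel K A B +>\<^bsub>?F\<^esub> x"
    using t unfolding tensor_carrier_iff by blast
  let ?U = "{p. x p \<noteq> \<zero>\<^bsub>K\<^esub>}"
  define ev where "ev = (\<lambda>d. \<Oplus>\<^bsub>Z\<^esub>p\<in>?U. x p \<odot>\<^bsub>Z\<^esub> \<gamma> d (fst p) (snd p))"
  have lift: "tensor_lift K Z (\<gamma> d) t = ev d" if "d \<in> carrier D" for d
    unfolding x(2) ev_def by (rule tensor_lift_coset[OF assms(1,2,4) \<gamma>[OF that] x(1)])
  have fin: "finite ?U" and sub: "?U \<subseteq> ?S" using x(1) by (auto simp: free_module_def)
  have l: "(\<lambda>d. \<gamma> d (fst p) (snd p)) \<in> linear_maps K D Z" if "p \<in> ?U" for p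
    using \<gamma>d[of "fst p" "snd p"] sub that by auto
  note c = free_module_closed[OF cr x(1)]
  have evc: "ev d \<in> carrier Z" if "d \<in> carrier D" for d
    unfolding ev_def
    by (rule Z.M.finsum_closed) (use c linear_mapsD(1)[OF l that] in auto)
  have eva: "ev (d \<oplus>\<^bsub>D\<^esub> e) = ev d \<oplus>\<^bsub>Z\<^esub> ev e" if "d \<in> carrier D" "e \<in> carrier D" for d e
  proof -
    have "ev (d \<oplus>\<^bsub>D\<^esub> e) =
      (\<Oplus>\<^bsub>Z\<^esub>p\<in>?U. x p \<odot>\<^bsub>Z\<^esub> \<gamma> d (fst p) (snd p) \<oplus>\<^bsub>Z\<^esub> x p \<odot>\<^bsub>Z\<^esub> \<gamma> e (fst p) (snd p))"
      unfolding ev_def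
      by (rule Z.M.finsum_cong'[OF refl])
         (use c linear_mapsD(1)[OF l] linear_mapsD(2)[OF l] that Z.smult_r_distr in auto)
    also have "\<dots> = ev d \<oplus>\<^bsub>Z\<^esub> ev e"
      unfolding ev_def
      by (rule Z.M.finsum_addf) (use c linear_mapsD(1)[OF l] that in auto)
    finally show ?thesis .
  qed
  have evs: "ev (r \<odot>\<^bsub>D\<^esub> d) = r \<odot>\<^bsub>Z\<^esub> ev d" if "r \<in> carrier K" "d \<in> carrier D" for r d
  proof -
    have sw: "x p \<odot>\<^bsub>Z\<^esub> (r \<odot>\<^bsub>Z\<^esub> z) = r \<odot>\<^bsub>Z\<^esub> (x p \<odot>\<^bsub>Z\<^esub> z)" if "z \<in> carrier Z" for p z
      using c[of p] \<open>r \<in> carrier K\<close> that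
      by (simp add: Z.smult_assoc1[symmetric] D.R.m_comm)
    have "ev (r \<odot>\<^bsub>D\<^esub> d) = (\<Oplus>\<^bsub>Z\<^esub>p\<in>?U. r \<odot>\<^bsub>Z\<^esub> (x p \<odot>\<^bsub>Z\<^esub> \<gamma> d (fst p) (snd p)))"
      unfolding ev_def
      by (rule Z.M.finsum_cong'[OF refl])
         (use c linear_mapsD(1)[OF l] linear_mapsD(3)[OF l] that sw in auto)
    also have "\<dots> = r \<odot>\<^bsub>Z\<^esub> ev d"
      unfolding ev_def
      by (rule Z.finsum_smult_ldistr[symmetric]) (use c fin linear_mapsD(1)[OF l] that in auto)
    finally show ?thesis .
  qed
  show ?thesis
    unfolding linear_maps_def using evc eva evs by (simp add: lift Pi_def)
qed

lemma tensor_assoc_bilinear: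
  assumes "module K A" "module K B" "module K D" and d: "d \<in> carrier D"
  shows "(\<lambda>a b. pure_tensor K A (tensor K B D) a (pure_tensor K B D b d))
    \<in> bilinear_maps K A B (tensor K A (tensor K B D))"
  unfolding bilinear_maps_def linear_maps_def
  using d bilinear_mapsD[OF pure_tensor_bilinear[OF assms(2,3)]]
    bilinear_mapsD[OF pure_tensor_bilinear[OF assms(1) tensor_module[OF assms(2,3)]]]
  by auto

lemma tensor_assoc_bilinear':
  assumes "module K A" "module K B" "module K D"
  defines "Z \<equiv> tensor K A (tensor K B D)"
  shows "(\<lambda>t d. tensor_lift K Z (\<lambda>a b. pure_tensor K A (tensor K B D) a (pure_tensor K B D b d)) t)
    \<in> bilinear_maps K (tensor K A B) D Z"
proof -
  have Z: "module K Z" unfolding Z_def by (intro tensor_module assms)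
  note p1 = bilinear_mapsD[OF pure_tensor_bilinear[OF assms(2,3)]]
  note p2 = bilinear_mapsD[OF pure_tensor_bilinear[OF assms(1) tensor_module[OF assms(2,3)]], folded Z_def]
  have "(\<lambda>d. tensor_lift K Z (\<lambda>a b. pure_tensor K A (tensor K B D) a (pure_tensor K B D b d)) t)
      \<in> linear_maps K D Z" if "t \<in> carrier (tensor K A B)" for t
    by (rule tensor_lift_linear_param[OF assms(1-3) Z _ _ that])
       (use tensor_assoc_bilinear[OF assms(1-3), folded Z_def] p1 p2 in \<open>auto simp: linear_maps_def\<close>)
  moreover have "(\<lambda>t. tensor_lift K Z (\<lambda>a b. pure_tensor K A (tensor K B D) a (pure_tensor K B D b d)) t)
      \<in> linear_maps K (tensor K A B) Z" if "d \<in> carrier D" for d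
    by (rule tensor_lift_linear[OF assms(1,2) Z tensor_assoc_bilinear[OF assms(1-3) that, folded Z_def]])
  ultimately show ?thesis unfolding bilinear_maps_def by blast
qed

lemma tensor_assoc_linear:
  assumes "module K A" "module K B" "module K D"
  shows "tensor_assoc K A B D \<in> linear_maps K (tensor K (tensor K A B) D) (tensor K A (tensor K B D))"
  unfolding tensor_assoc_def Let_def
  by (rule tensor_lift_linear[OF tensor_module[OF assms(1,2)] assms(3)
        tensor_module[OF assms(1) tensor_module[OF assms(2,3)]] tensor_assoc_bilinear'[OF assms]])

lemma tensor_assoc_pure:
  assumes "module K A" "module K B" "module K D"
    and "a \<in> carrier A" "b \<in> carrier B" "d \<in> carrier D"
  shows "tensor_assoc K A B D (pure_tensor K (tensor K A B) D (pure_tensor K A B a b) d) =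
    pure_tensor K A (tensor K B D) a (pure_tensor K B D b d)"
proof -
  have Z: "module K (tensor K A (tensor K B D))" by (intro tensor_module assms)
  have ab: "pure_tensor K A B a b \<in> carrier (tensor K A B)"
    by (rule bilinear_mapsD(1)[OF pure_tensor_bilinear[OF assms(1,2)] assms(4,5)])
  show ?thesis
    unfolding tensor_assoc_def Let_def
      tensor_lift_pure[OF tensor_module[OF assms(1,2)] assms(3) Z tensor_assoc_bilinear'[OF assms(1-3)] ab assms(6)]
    by (rule tensor_lift_pure[OF assms(1,2) Z tensor_assoc_bilinear[OF assms(1-3,6)] assms(4,5)])
qed


section \<open>Coalgebras, comodules and Rota-Baxter paired comodules\<close>

text \<open>The counit laws are stated through the canonical isomorphisms \<open>x \<mapsto> 1 \<otimes> x\<close> and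
  \<open>x \<mapsto> x \<otimes> 1\<close> from \<open>M\<close> to \<open>K \<otimes> M\<close> and \<open>M \<otimes> K\<close>.\<close>

locale coalgebra = field K + module K C
  for K :: "('k, 'r) ring_scheme" and C :: "('k, 'c, 'x) module_scheme" +
  fixes \<Delta> :: "'c \<Rightarrow> ('c \<times> 'c \<Rightarrow> 'k) set" and \<epsilon> :: "'c \<Rightarrow> 'k"
  assumes comult_linear: "\<Delta> \<in> linear_maps K C (tensor K C C)"
    and counit_linear: "\<epsilon> \<in> linear_maps K C (ring_as_module K)"
    and coassociative: "c \<in> carrier C \<Longrightarrow>
      tensor_assoc K C C C (tensor_map K (tensor K C C) C \<Delta> id (\<Delta> c)) =
      tensor_map K C (tensor K C C) id \<Delta> (\<Delta> c)"
    and counit_left: "c \<in> carrier C \<Longrightarrow>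
      tensor_map K (ring_as_module K) C \<epsilon> id (\<Delta> c) = pure_tensor K (ring_as_module K) C \<one>\<^bsub>K\<^esub> c"
    and counit_right: "c \<in> carrier C \<Longrightarrow>
      tensor_map K C (ring_as_module K) id \<epsilon> (\<Delta> c) = pure_tensor K C (ring_as_module K) c \<one>\<^bsub>K\<^esub>"

locale left_comodule = coalgebra K C \<Delta> \<epsilon> + M: module K M
  for K :: "('k, 'r) ring_scheme" and C :: "('k, 'c, 'x) module_scheme"
    and \<Delta> :: "'c \<Rightarrow> ('c \<times> 'c \<Rightarrow> 'k) set" and \<epsilon> :: "'c \<Rightarrow> 'k"
    and M :: "('k, 'm, 'y) module_scheme" +
  fixes \<rho> :: "'m \<Rightarrow> ('c \<times> 'm \<Rightarrow> 'k) set"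
  assumes coaction_linear: "\<rho> \<in> linear_maps K M (tensor K C M)"
    and coaction_coassociative: "m \<in> carrier M \<Longrightarrow>
      tensor_assoc K C C M (tensor_map K (tensor K C C) M \<Delta> id (\<rho> m)) =
      tensor_map K C (tensor K C M) id \<rho> (\<rho> m)"
    and coaction_counit: "m \<in> carrier M \<Longrightarrow>
      tensor_map K (ring_as_module K) M \<epsilon> id (\<rho> m) = pure_tensor K (ring_as_module K) M \<one>\<^bsub>K\<^esub> m"

locale rota_baxter_paired_comodule = left_comodule K C \<Delta> \<epsilon> M \<rho>
  for K :: "('k, 'r) ring_scheme" and C :: "('k, 'c, 'x) module_scheme"
    and \<Delta> :: "'c \<Rightarrow> ('c \<times> 'c \<Rightarrow> 'k) set" and \<epsilon> :: "'c \<Rightarrow> 'k"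
    and M :: "('k, 'm, 'y) module_scheme" and \<rho> :: "'m \<Rightarrow> ('c \<times> 'm \<Rightarrow> 'k) set" +
  fixes lam :: 'k and P :: "'c \<Rightarrow> 'c" and T :: "'m \<Rightarrow> 'm"
  assumes weight_closed: "lam \<in> carrier K"
    and P_linear: "P \<in> linear_maps K C C"
    and T_linear: "T \<in> linear_maps K M M"
    and rota_baxter: "m \<in> carrier M \<Longrightarrow>
      tensor_map K C M P T (\<rho> m) =
        tensor_map K C M P id (\<rho> (T m)) \<oplus>\<^bsub>tensor K C M\<^esub>
        tensor_map K C M id T (\<rho> (T m)) \<oplus>\<^bsub>tensor K C M\<^esub>
        lam \<odot>\<^bsub>tensor K C M\<^esub> \<rho> (T m)"

end

theory Submission
  imports Defs
begin

text \<open>Write \<open>u = \<rho> (T m)\<close>, \<open>v = \<rho> m\<close> and \<open>w = - u - \<lambda> v\<close>, the image under \<open>\<rho>\<close> of the negated and shifted \<open>T m\<close>.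
  Since \<open>f \<otimes> g\<close> is linear in \<open>f\<close> and in \<open>g\<close>, the right hand side of the new Rota-Baxter identity is
  \<open>- (P \<otimes> id) w - (id \<otimes> T) w - \<lambda> w\<close>. Its \<open>u\<close>-part is \<open>(P \<otimes> T) v\<close> by the old identity, so it
  agrees with the expansion of the left hand side,
  \<open>(P \<otimes> T) v + \<lambda> (P \<otimes> id) v + \<lambda> (id \<otimes> T) v + \<lambda>\<^sup>2 v\<close>.\<close>

section \<open>Linear maps: combinations and extensionality on generators\<close>

lemma linear_maps_cong:
  assumes "module K A" "f \<in> linear_maps K A B" "\<And>x. x \<in> carrier A \<Longrightarrow> g x = f x"
  shows "g \<in> linear_maps K A B"
proof -
  interpret A: module K A by fact
  show ?thesis using assms(2,3) unfolding linear_maps_def by auto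
qed

lemma linear_maps_id: "id \<in> linear_maps K A A"
  by (simp add: linear_maps_def)

text \<open>Two summands with arbitrary coefficients suffice here: both new operators have this
  form, with coefficients -1 and \<open>- lam\<close> and with the identity as second map.\<close>

lemma linear_maps_lincomb:
  assumes "module K A" "module K B" "f \<in> linear_maps K A B" "g \<in> linear_maps K A B"
    and "r \<in> carrier K" "s \<in> carrier K"
  shows "(\<lambda>x. r \<odot>\<^bsub>B\<^esub> f x \<oplus>\<^bsub>B\<^esub> s \<odot>\<^bsub>B\<^esub> g x) \<in> linear_maps K A B"
proof -
  interpret A: module K A by fact
  interpret B: module K B by fact
  note f = linear_mapsD[OF assms(3)]
  note g = linear_mapsD[OF assms(4)]
  \<comment> \<open>Homogeneity requires moving a scalar past \<open>r\<close> and \<open>s\<close>;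
    this is where commutativity of \<open>K\<close> enters.\<close>
  have comm: "r \<odot>\<^bsub>B\<^esub> (t \<odot>\<^bsub>B\<^esub> b) = t \<odot>\<^bsub>B\<^esub> (r \<odot>\<^bsub>B\<^esub> b)"
    if "r \<in> carrier K" "t \<in> carrier K" "b \<in> carrier B" for r t b
    using that by (simp add: B.smult_assoc1[symmetric] A.R.m_comm)
  show ?thesis
    unfolding linear_maps_def using assms(5,6)
    by (auto simp: f g B.smult_r_distr B.M.a_ac comm)
qed

text \<open>Elements of the free module have finite support, so induction on the support works:
  splitting off one point \<open>s\<close> writes \<open>x\<close> as an element with smaller
  support plus a multiple of the generator at \<open>s\<close>.\<close>

lemma free_module_linear_ext:
  assumes "cring K" "module K D"
    and f: "f \<in> linear_maps K (free_module K S) D"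
    and g: "g \<in> linear_maps K (free_module K S) D"
    and eq: "\<And>s. s \<in> S \<Longrightarrow> f (free_gen K s) = g (free_gen K s)"
    and x: "x \<in> carrier (free_module K S)"
  shows "f x = g x"
proof -
  let ?F = "free_module K S"
  interpret K: cring K by fact
  have modF: "module K ?F" using assms(1) by (rule free_module_module)
  interpret F: module K ?F by (rule modF)
  have "finite {s. x s \<noteq> \<zero>\<^bsub>K\<^esub>}" using x by (simp add: free_module_def)
  then show ?thesis using x
  proof (induction "{s. x s \<noteq> \<zero>\<^bsub>K\<^esub>}" arbitrary: x rule: finite_induct)
    case empty
    then have "x = \<zero>\<^bsub>?F\<^esub>" by (auto simp: free_module_def)
    then show ?case
      using linear_maps_zero[OF modF assms(2) f] linear_maps_zero[OF modF assms(2) g] by simp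
  next
    case (insert s U)
    \<comment> \<open>Erasing the coefficient at \<open>s\<close> leaves support exactly
      \<open>U\<close>, as the induction hypothesis demands.\<close>
    let ?y = "x(s := \<zero>\<^bsub>K\<^esub>)"
    have y: "{t. ?y t \<noteq> \<zero>\<^bsub>K\<^esub>} = U" using insert.hyps(2,4) by auto
    have s: "s \<in> S" using insert.hyps(4) insert.prems by (auto simp: free_module_def)
    have yF: "?y \<in> carrier ?F"
      using insert.prems y insert.hyps(1) by (auto simp: free_module_def)
    have xs: "x t \<in> carrier K" for t
      using free_module_closed[OF assms(1) insert.prems] .
    note gen = free_gen_closed[OF assms(1) s]
    have "x = ?y \<oplus>\<^bsub>?F\<^esub> x s \<odot>\<^bsub>?F\<^esub> free_gen K s"
      by (rule ext) (simp add: free_module_def free_gen_def xs)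
    moreover have "h (?y \<oplus>\<^bsub>?F\<^esub> x s \<odot>\<^bsub>?F\<^esub> free_gen K s) = h ?y \<oplus>\<^bsub>D\<^esub> x s \<odot>\<^bsub>D\<^esub> h (free_gen K s)"
      if "h \<in> linear_maps K ?F D" for h
      using linear_mapsD(2)[OF that yF] linear_mapsD(3)[OF that gen xs] xs gen by simp
    ultimately show ?case
      using f g eq[OF s] insert.hyps(3)[OF y[symmetric] yF] by metis
  qed
qed

text \<open>Precomposing with the quotient map from the free module turns \<open>f\<close> and
  \<open>g\<close> into linear maps on that free module. Pure tensors are the images of the
  generators, and every tensor is a coset, so extensionality on the free module applies.\<close>

lemma tensor_linear_ext:
  assumes "module K A" "module K B" "module K D"
    and f: "f \<in> linear_maps K (tensor K A B) D"
    and g: "g \<in> linear_maps K (tensor K A B) D"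
    and eq: "\<And>a b. a \<in> carrier A \<Longrightarrow> b \<in> carrier B \<Longrightarrow>
      f (pure_tensor K A B a b) = g (pure_tensor K A B a b)"
    and X: "X \<in> carrier (tensor K A B)"
  shows "f X = g X"
proof -
  let ?F = "free_module K (carrier A \<times> carrier B)"
  let ?q = "\<lambda>x. tensor_kernel K A B +>\<^bsub>?F\<^esub> x"
  have cr: "cring K" using assms(1) by (rule module.axioms(1))
  have modF: "module K ?F" using cr by (rule free_module_module)
  interpret F: module K ?F by (rule modF)
  note ops = quotient_module_ops[OF modF tensor_kernel_submodule[OF assms(1,2)], folded tensor_def]
  have q: "?q x \<in> carrier (tensor K A B)" if "x \<in> carrier ?F" for x
    using that unfolding tensor_carrier_iff by blast
  have comp: "(\<lambda>x. h (?q x)) \<in> linear_maps K ?F D"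
    if h: "h \<in> linear_maps K (tensor K A B) D" for h
    unfolding linear_maps_def
  proof (intro CollectI conjI ballI funcsetI)
    fix x assume x: "x \<in> carrier ?F"
    show "h (?q x) \<in> carrier D" by (rule linear_mapsD(1)[OF h q[OF x]])
    show "h (?q (x \<oplus>\<^bsub>?F\<^esub> y)) = h (?q x) \<oplus>\<^bsub>D\<^esub> h (?q y)" if y: "y \<in> carrier ?F" for y
      unfolding ops(1)[OF x y, symmetric] by (rule linear_mapsD(2)[OF h q[OF x] q[OF y]])
    show "h (?q (r \<odot>\<^bsub>?F\<^esub> x)) = r \<odot>\<^bsub>D\<^esub> h (?q x)" if r: "r \<in> carrier K" for r
      unfolding ops(2)[OF x r, symmetric] by (rule linear_mapsD(3)[OF h q[OF x] r])
  qed
  obtain x where x: "x \<in> carrier ?F" "X = ?q x" using X unfolding tensor_carrier_iff by blast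
  show ?thesis unfolding x(2)
    by (rule free_module_linear_ext[OF cr assms(3) comp[OF f] comp[OF g] _ x(1)])
       (use eq in \<open>auto simp: pure_tensor_def\<close>)
qed

section \<open>Identity and linearity in each factor for tensor products of maps\<close>

lemma tensor_map_id:
  assumes "module K A" "module K B" "X \<in> carrier (tensor K A B)"
  shows "tensor_map K A B id id X = X"
proof -
  have "tensor_map K A B id id X = id X"
    by (rule tensor_linear_ext[OF assms(1,2) tensor_module[OF assms(1,2)]
          tensor_map_linear[OF assms(1,2,1,2) linear_maps_id linear_maps_id] linear_maps_id _ assms(3)])
       (simp add: tensor_map_pure[OF assms(1,2,1,2) linear_maps_id linear_maps_id])
  then show ?thesis by simp
qed

text \<open>Both sides are linear in \<open>X\<close>, and on pure tensors they agree because
  \<open>pure_tensor\<close> is bilinear. The hypothesis on \<open>h\<close> is pointwise on the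
  carrier, so \<open>h\<close> may be given by a formula that is a combination only there.\<close>

lemma tensor_map_lincomb_left:
  assumes mods: "module K A" "module K B" "module K A'" "module K B'"
    and f: "f \<in> linear_maps K A A'" "f' \<in> linear_maps K A A'" and g: "g \<in> linear_maps K B B'"
    and rs: "r \<in> carrier K" "s \<in> carrier K"
    and h: "\<And>a. a \<in> carrier A \<Longrightarrow> h a = r \<odot>\<^bsub>A'\<^esub> f a \<oplus>\<^bsub>A'\<^esub> s \<odot>\<^bsub>A'\<^esub> f' a"
    and X: "X \<in> carrier (tensor K A B)"
  shows "tensor_map K A' B' h g X =
    r \<odot>\<^bsub>tensor K A' B'\<^esub> tensor_map K A' B' f g X \<oplus>\<^bsub>tensor K A' B'\<^esub>
    s \<odot>\<^bsub>tensor K A' B'\<^esub> tensor_map K A' B' f' g X"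
proof -
  interpret A': module K A' by fact
  note tm = tensor_module[OF mods(1,2)] tensor_module[OF mods(3,4)]
  have hl: "h \<in> linear_maps K A A'"
    by (rule linear_maps_cong[OF mods(1) linear_maps_lincomb[OF mods(1,3) f rs] h])
  note lin = tensor_map_linear[OF mods _ g]
  note pure = tensor_map_pure[OF mods _ g]
  show ?thesis
    by (rule tensor_linear_ext[OF mods(1,2) tm(2) lin[OF hl]
          linear_maps_lincomb[OF tm lin[OF f(1)] lin[OF f(2)] rs] _ X])
       (simp add: pure hl f h rs linear_mapsD(1)[OF f(1)] linear_mapsD(1)[OF f(2)]
          linear_mapsD(1)[OF g] bilinear_mapsD[OF pure_tensor_bilinear[OF mods(3,4)]])
qed

lemma tensor_map_lincomb_right:
  assumes mods: "module K A" "module K B" "module K A'" "module K B'"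
    and f: "f \<in> linear_maps K A A'" and g: "g \<in> linear_maps K B B'" "g' \<in> linear_maps K B B'"
    and rs: "r \<in> carrier K" "s \<in> carrier K"
    and h: "\<And>b. b \<in> carrier B \<Longrightarrow> h b = r \<odot>\<^bsub>B'\<^esub> g b \<oplus>\<^bsub>B'\<^esub> s \<odot>\<^bsub>B'\<^esub> g' b"
    and X: "X \<in> carrier (tensor K A B)"
  shows "tensor_map K A' B' f h X =
    r \<odot>\<^bsub>tensor K A' B'\<^esub> tensor_map K A' B' f g X \<oplus>\<^bsub>tensor K A' B'\<^esub>
    s \<odot>\<^bsub>tensor K A' B'\<^esub> tensor_map K A' B' f g' X"
proof -
  interpret B': module K B' by fact
  note tm = tensor_module[OF mods(1,2)] tensor_module[OF mods(3,4)]
  have hl: "h \<in> linear_maps K B B'"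
    by (rule linear_maps_cong[OF mods(2) linear_maps_lincomb[OF mods(2,4) g rs] h])
  note lin = tensor_map_linear[OF mods f]
  note pure = tensor_map_pure[OF mods f]
  show ?thesis
    by (rule tensor_linear_ext[OF mods(1,2) tm(2) lin[OF hl]
          linear_maps_lincomb[OF tm lin[OF g(1)] lin[OF g(2)] rs] _ X])
       (simp add: pure hl g h rs linear_mapsD(1)[OF g(1)] linear_mapsD(1)[OF g(2)]
          linear_mapsD(1)[OF f] bilinear_mapsD[OF pure_tensor_bilinear[OF mods(3,4)]])
qed

section \<open>The Rota-Baxter identity for the negated and shifted operators\<close>

lemma module_minus_minus_smult:
  assumes "module K A" "r \<in> carrier K" "x \<in> carrier A" "y \<in> carrier A"
  shows "\<ominus>\<^bsub>A\<^esub> x \<ominus>\<^bsub>A\<^esub> r \<odot>\<^bsub>A\<^esub> y =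
    (\<ominus>\<^bsub>K\<^esub> \<one>\<^bsub>K\<^esub>) \<odot>\<^bsub>A\<^esub> x \<oplus>\<^bsub>A\<^esub> (\<ominus>\<^bsub>K\<^esub> r) \<odot>\<^bsub>A\<^esub> y"
proof -
  interpret A: module K A by fact
  show ?thesis using assms(2-4) by (simp add: a_minus_def A.smult_l_minus)
qed

theorem proposition4p15:
  fixes K :: "('k, 'r) ring_scheme"
    and C :: "('k, 'c, 'x) module_scheme"
    and \<Delta> :: "'c \<Rightarrow> ('c \<times> 'c \<Rightarrow> 'k) set"
    and \<epsilon> :: "'c \<Rightarrow> 'k"
    and M :: "('k, 'm, 'y) module_scheme"
    and \<rho> :: "'m \<Rightarrow> ('c \<times> 'm \<Rightarrow> 'k) set"
    and lam :: 'k
    and P :: "'c \<Rightarrow> 'c"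
    and T :: "'m \<Rightarrow> 'm"
  assumes "field K"
    and "lam \<in> carrier K"
    and "coalgebra K C \<Delta> \<epsilon>"
    and "rota_baxter_paired_comodule K C \<Delta> \<epsilon> M \<rho> lam P T"
  shows "rota_baxter_paired_comodule K C \<Delta> \<epsilon> M \<rho> lam
           (\<lambda>c. (\<ominus>\<^bsub>C\<^esub> P c) \<ominus>\<^bsub>C\<^esub> (lam \<odot>\<^bsub>C\<^esub> c))
           (\<lambda>m. (\<ominus>\<^bsub>M\<^esub> T m) \<ominus>\<^bsub>M\<^esub> (lam \<odot>\<^bsub>M\<^esub> m))"
proof -
  let ?P = "\<lambda>c. (\<ominus>\<^bsub>C\<^esub> P c) \<ominus>\<^bsub>C\<^esub> (lam \<odot>\<^bsub>C\<^esub> c)"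
  let ?T = "\<lambda>m. (\<ominus>\<^bsub>M\<^esub> T m) \<ominus>\<^bsub>M\<^esub> (lam \<odot>\<^bsub>M\<^esub> m)"
  let ?Q = "tensor K C M"
  interpret RB: rota_baxter_paired_comodule K C \<Delta> \<epsilon> M \<rho> lam P T by fact
  have C: "module K C" and M: "module K M" by unfold_locales
  have Q: "module K ?Q" by (rule tensor_module[OF C M])
  interpret Q: module K ?Q by (rule Q)
  note P = RB.P_linear and T = RB.T_linear and rho = RB.coaction_linear
  have lam: "lam \<in> carrier K" by fact
  have rs: "\<ominus>\<^bsub>K\<^esub> \<one>\<^bsub>K\<^esub> \<in> carrier K" "\<ominus>\<^bsub>K\<^esub> lam \<in> carrier K" using lam by auto
  \<comment> \<open>Writing \<open>id c\<close> for \<open>c\<close> exhibits the identity as the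
    second map of the combination. The equation is available only on the carrier, hence the use of
    \<open>linear_maps_cong\<close> for \<open>P'\<close>, and likewise for
    \<open>T'\<close>.\<close>
  have P_eq: "?P c = (\<ominus>\<^bsub>K\<^esub> \<one>\<^bsub>K\<^esub>) \<odot>\<^bsub>C\<^esub> P c \<oplus>\<^bsub>C\<^esub> (\<ominus>\<^bsub>K\<^esub> lam) \<odot>\<^bsub>C\<^esub> id c" if "c \<in> carrier C" for c
    using module_minus_minus_smult[OF C lam linear_mapsD(1)[OF P that] that] by simp
  have T_eq: "?T m = (\<ominus>\<^bsub>K\<^esub> \<one>\<^bsub>K\<^esub>) \<odot>\<^bsub>M\<^esub> T m \<oplus>\<^bsub>M\<^esub> (\<ominus>\<^bsub>K\<^esub> lam) \<odot>\<^bsub>M\<^esub> id m" if "m \<in> carrier M" for m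
    using module_minus_minus_smult[OF M lam linear_mapsD(1)[OF T that] that] by simp
  have P': "?P \<in> linear_maps K C C"
    by (rule linear_maps_cong[OF C linear_maps_lincomb[OF C C P linear_maps_id rs] P_eq])
  have T': "?T \<in> linear_maps K M M"
    by (rule linear_maps_cong[OF M linear_maps_lincomb[OF M M T linear_maps_id rs] T_eq])
  note tl = tensor_map_linear[OF C M C M]
  note tc = linear_mapsD(1)[OF tl]
  \<comment> \<open>Expansion in the first factor, converted back from coefficients -1 and
    \<open>- lam\<close> to subtraction inside the tensor product; \<open>right\<close> does the
    same for the second factor.\<close>
  have left: "tensor_map K C M ?P g X =
      \<ominus>\<^bsub>?Q\<^esub> tensor_map K C M P g X \<ominus>\<^bsub>?Q\<^esub> lam \<odot>\<^bsub>?Q\<^esub> tensor_map K C M id g X"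
    if "g \<in> linear_maps K M M" "X \<in> carrier ?Q" for g X
    using module_minus_minus_smult[OF Q lam tc[OF P that] tc[OF linear_maps_id that]]
      tensor_map_lincomb_left[OF C M C M P linear_maps_id that(1) rs P_eq that(2)] by (simp add: id_def)
  have right: "tensor_map K C M f ?T X =
      \<ominus>\<^bsub>?Q\<^esub> tensor_map K C M f T X \<ominus>\<^bsub>?Q\<^esub> lam \<odot>\<^bsub>?Q\<^esub> tensor_map K C M f id X"
    if "f \<in> linear_maps K C C" "X \<in> carrier ?Q" for f X
    using module_minus_minus_smult[OF Q lam tc[OF that(1) T that(2)] tc[OF that(1) linear_maps_id that(2)]]
      tensor_map_lincomb_right[OF C M C M that(1) T linear_maps_id rs T_eq that(2)] by (simp add: id_def)
  \<comment> \<open>The domain is kept general because two are needed: \<open>M\<close> for the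
    coaction, and the tensor product itself for \<open>P \<otimes> id\<close> and
    \<open>id \<otimes> T\<close>.\<close>
  have lin: "h (\<ominus>\<^bsub>A\<^esub> x \<ominus>\<^bsub>A\<^esub> lam \<odot>\<^bsub>A\<^esub> y) = \<ominus>\<^bsub>?Q\<^esub> h x \<ominus>\<^bsub>?Q\<^esub> lam \<odot>\<^bsub>?Q\<^esub> h y"
    if A: "module K A" and h: "h \<in> linear_maps K A ?Q" and xy: "x \<in> carrier A" "y \<in> carrier A"
    for A :: "('k, 'z, 'w) module_scheme" and h x y
  proof -
    interpret A: module K A by (rule A)
    show ?thesis
      using linear_mapsD[OF h] xy lam rs
      by (simp add: module_minus_minus_smult[OF A] module_minus_minus_smult[OF Q])
  qed
  \<comment> \<open>Applied with \<open>z\<close> equal to \<open>lam\<close> times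
    \<open>w\<close>: each of the two expanded operator terms contributes \<open>- z\<close>, and
    the weight term \<open>+ z\<close> cancels one of them.\<close>
  have cancel: "(\<ominus>\<^bsub>?Q\<^esub> x \<ominus>\<^bsub>?Q\<^esub> z) \<oplus>\<^bsub>?Q\<^esub> (\<ominus>\<^bsub>?Q\<^esub> y \<ominus>\<^bsub>?Q\<^esub> z) \<oplus>\<^bsub>?Q\<^esub> z = \<ominus>\<^bsub>?Q\<^esub> x \<ominus>\<^bsub>?Q\<^esub> y \<ominus>\<^bsub>?Q\<^esub> z"
    if "x \<in> carrier ?Q" "y \<in> carrier ?Q" "z \<in> carrier ?Q" for x y z
  proof -
    have "(\<ominus>\<^bsub>?Q\<^esub> x \<ominus>\<^bsub>?Q\<^esub> z) \<oplus>\<^bsub>?Q\<^esub> (\<ominus>\<^bsub>?Q\<^esub> y \<ominus>\<^bsub>?Q\<^esub> z) \<oplus>\<^bsub>?Q\<^esub> z =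
        (\<ominus>\<^bsub>?Q\<^esub> x \<ominus>\<^bsub>?Q\<^esub> y \<ominus>\<^bsub>?Q\<^esub> z) \<oplus>\<^bsub>?Q\<^esub> (\<ominus>\<^bsub>?Q\<^esub> z \<oplus>\<^bsub>?Q\<^esub> z)"
      using that by (simp add: a_minus_def Q.M.a_ac)
    then show ?thesis using that by (simp add: Q.M.l_neg)
  qed
  show ?thesis
  \<comment> \<open>The comodule axioms do not mention the operators and are inherited from
    \<open>RB\<close>; the identity is proved below, while linearity and the weight condition are
    closed at the end.\<close>
  proof (intro_locales, unfold_locales)
    fix m assume m: "m \<in> carrier M"
    have Tm: "T m \<in> carrier M" by (rule linear_mapsD(1)[OF T m])
    define u v w where "u = \<rho> (T m)" and "v = \<rho> m" and "w = \<rho> (?T m)"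
    have u: "u \<in> carrier ?Q" and v: "v \<in> carrier ?Q"
      unfolding u_def v_def using linear_mapsD(1)[OF rho] m Tm by auto
    have w: "w = \<ominus>\<^bsub>?Q\<^esub> u \<ominus>\<^bsub>?Q\<^esub> lam \<odot>\<^bsub>?Q\<^esub> v"
      unfolding u_def v_def w_def by (rule lin[OF M rho Tm m])
    have wc: "w \<in> carrier ?Q" using u v lam by (simp add: w)
    let ?p = "tensor_map K C M P id" and ?t = "tensor_map K C M id T"
    note pl = tl[OF P linear_maps_id] and tl' = tl[OF linear_maps_id T]
    note closed = u v wc lam linear_mapsD(1)[OF pl] linear_mapsD(1)[OF tl']
    have id: "tensor_map K C M id id X = X" if "X \<in> carrier ?Q" for X
      by (rule tensor_map_id[OF C M that])
    have pw: "?p w = \<ominus>\<^bsub>?Q\<^esub> ?p u \<ominus>\<^bsub>?Q\<^esub> lam \<odot>\<^bsub>?Q\<^esub> ?p v" and tw: "?t w = \<ominus>\<^bsub>?Q\<^esub> ?t u \<ominus>\<^bsub>?Q\<^esub> lam \<odot>\<^bsub>?Q\<^esub> ?t v"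
      unfolding w using lin[OF Q pl u v] lin[OF Q tl' u v] by auto
    have rb: "tensor_map K C M P T v = ?p u \<oplus>\<^bsub>?Q\<^esub> ?t u \<oplus>\<^bsub>?Q\<^esub> lam \<odot>\<^bsub>?Q\<^esub> u"
      unfolding u_def v_def by (rule RB.rota_baxter[OF m])
    have "tensor_map K C M ?P id w \<oplus>\<^bsub>?Q\<^esub> tensor_map K C M id ?T w \<oplus>\<^bsub>?Q\<^esub> lam \<odot>\<^bsub>?Q\<^esub> w =
        \<ominus>\<^bsub>?Q\<^esub> ?p w \<ominus>\<^bsub>?Q\<^esub> ?t w \<ominus>\<^bsub>?Q\<^esub> lam \<odot>\<^bsub>?Q\<^esub> w"
      unfolding left[OF linear_maps_id wc] right[OF linear_maps_id wc] id[OF wc]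
      by (rule cancel) (use closed in auto)
    also have "\<dots> = tensor_map K C M ?P ?T v"
      unfolding left[OF T' v] right[OF P v] right[OF linear_maps_id v] id[OF v] rb pw tw
      \<comment> \<open>The equation \<open>w\<close> comes after \<open>pw\<close> and
        \<open>tw\<close>, whose left sides contain \<open>w\<close> itself; by now it only has to
        expand the weight term. Both sides are then sums in the images of \<open>u\<close> and
        \<open>v\<close>, equal up to reordering.\<close>
      unfolding w using closed
      by (simp add: a_minus_def Q.M.minus_add Q.smult_r_distr Q.smult_r_minus Q.M.a_ac)
    finally show "tensor_map K C M ?P ?T (\<rho> m) =
        tensor_map K C M ?P id (\<rho> (?T m)) \<oplus>\<^bsub>?Q\<^esub>
        tensor_map K C M id ?T (\<rho> (?T m)) \<oplus>\<^bsub>?Q\<^esub> lam \<odot>\<^bsub>?Q\<^esub> \<rho> (?T m)"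
      unfolding v_def w_def by simp
  qed (use P' T' lam in auto)
qed

end
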